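(* Let $G_1 \in ER(n_1,d_1,\lambda_1)$ have a uniform shared neighborhood structure isomorphic to $H_1$, and let $G_2 \in ER(n_2,d_2,\lambda_2)$ have a uniform shared neighborhood structure isomorphic to $H_2$. Then $G_1\otimes G_2 \in ER(n_1n_2,d_1d_2,\lambda_1\lambda_2)$ and $G_1\otimes G_2$ has a uniform shared neighborhood structure isomorphic to $H_1\otimes H_2$.
   Context: For a finite simple graph $G$, $N(u)$ is the open neighborhood of $u$. $G \in ER(n,d,\lambda)$ means $G$ has $n$ vertices, is $d$-regular, and every pair of adjacent vertices has exactly $\lambda$ common neighbors. $G$ has a uniform shared neighborhood structure isomorphic to $H$ if the induced subgraph $G[N(u)\cap N(v)]$ is isomorphic to $H$ for all adjacent $u,v$. The tensor product $G_1\otimes G_2$ has vertex set $V(G_1)\times V(G_2)$, with $(u,u')\sim(v,v')$ iff $u\sim v$ in $G_1$ and $u'\sim v'$ in $G_2$. *)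

theory Defs
  imports "Graph_Theory.Digraph_Isomorphism" "Graph_Theory.Pair_Digraph"
begin

text \<open>
  Finite simple graphs are the \<^locale>\<open>pair_graph\<close> records: a finite vertex set with a symmetric,
  irreflexive adjacency relation \<^const>\<open>parcs\<close> on it.
\<close>

definition nbhd :: "'a pair_pre_digraph \<Rightarrow> 'a \<Rightarrow> 'a set" where
  "nbhd G u = {v \<in> pverts G. (u, v) \<in> parcs G}"

definition ER :: "nat \<Rightarrow> nat \<Rightarrow> nat \<Rightarrow> 'a pair_pre_digraph set" where
  "ER n d l = {G. pair_graph G \<and> card (pverts G) = n
     \<and> (\<forall>u \<in> pverts G. card (nbhd G u) = d)
     \<and> (\<forall>u v. (u, v) \<in> parcs G \<longrightarrow> card (nbhd G u \<inter> nbhd G v) = l)}"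

text \<open>
  The graph \<open>H\<close> may live on a different vertex type. That it is itself a finite simple graph is part
  of the notion; this only matters when \<open>G\<close> has no edges.
\<close>

definition uniform_shared_nbhd :: "'a pair_pre_digraph \<Rightarrow> 'b pair_pre_digraph \<Rightarrow> bool" where
  "uniform_shared_nbhd G H \<longleftrightarrow> pair_graph H
     \<and> (\<forall>u v. (u, v) \<in> parcs G \<longrightarrow>
          digraph_iso (with_proj G \<restriction> (nbhd G u \<inter> nbhd G v)) (with_proj H))"

definition tensor_product ::
  "'a pair_pre_digraph \<Rightarrow> 'b pair_pre_digraph \<Rightarrow> ('a \<times> 'b) pair_pre_digraph" where
  "tensor_product G1 G2 =
     \<lparr> pverts = pverts G1 \<times> pverts G2,
       parcs = {((u, u'), (v, v')) | u u' v v'. (u, v) \<in> parcs G1 \<and> (u', v') \<in> parcs G2} \<rparr>"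

end

theory Submission
  imports Defs
begin

text \<open>
  Neighbourhoods in a tensor product are Cartesian products of neighbourhoods in the factors.
  Intersection commutes with Cartesian product, so the subgraph induced on a shared neighbourhood
  is the tensor product of the subgraphs induced in the factors, and tensor products preserve
  isomorphism.
\<close>

lemma pverts_tensor_product [simp]: "pverts (tensor_product G1 G2) = pverts G1 \<times> pverts G2"
  by (simp add: tensor_product_def)

lemma parcs_tensor_product_iff [simp]:
  "((u, u'), (v, v')) \<in> parcs (tensor_product G1 G2) \<longleftrightarrow>
     (u, v) \<in> parcs G1 \<and> (u', v') \<in> parcs G2"
  by (simp add: tensor_product_def)

lemma nbhd_tensor_product: "nbhd (tensor_product G1 G2) (u, u') = nbhd G1 u \<times> nbhd G2 u'"
  by (auto simp: nbhd_def)

text \<open>Serves twice: for the product of the graphs in \<open>ER\<close>, and for the product of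
  the model graphs in \<open>uniform_shared_nbhd\<close>.\<close>

lemma pair_graph_tensor_product:
  assumes "pair_graph G1" and "pair_graph G2"
  shows "pair_graph (tensor_product G1 G2)"
proof -
  interpret G1: pair_graph G1 by fact
  interpret G2: pair_graph G2 by fact
  have "parcs (tensor_product G1 G2)
      \<subseteq> (pverts G1 \<times> pverts G2) \<times> (pverts G1 \<times> pverts G2)"
    by (auto dest: G1.wellformed' G2.wellformed')
  then have "finite (parcs (tensor_product G1 G2))"
    by (rule finite_subset) (simp add: G1.pair_finite_verts G2.pair_finite_verts)
  moreover have "symmetric (with_proj (tensor_product G1 G2))"
    by (auto simp: symmetric_def sym_def intro: G1.arcs_symmetric G2.arcs_symmetric)
  ultimately show ?thesis
    by unfold_locales
      (auto simp: G1.pair_finite_verts G2.pair_finite_verts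
        dest: G1.wellformed' G2.wellformed' G1.no_loops')
qed

text \<open>Each of the three parameters counts a Cartesian product, so they multiply; an arc of the
  product projects to arcs of both factors, so both hypotheses on shared neighbourhoods
  apply.\<close>

lemma ER_tensor_product:
  assumes "G1 \<in> ER n1 d1 l1" and "G2 \<in> ER n2 d2 l2"
  shows "tensor_product G1 G2 \<in> ER (n1 * n2) (d1 * d2) (l1 * l2)"
  using assms
  by (auto simp: ER_def pair_graph_tensor_product nbhd_tensor_product Times_Int_Times
      card_cartesian_product)

text \<open>\<open>\<restriction>\<close> yields a general digraph, whereas
  \<open>tensor_product\<close> acts on pair digraphs; this version keeps the induced subgraph in
  the latter type.\<close>

definition pair_induced :: "'a pair_pre_digraph \<Rightarrow> 'a set \<Rightarrow> 'a pair_pre_digraph" where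
  "pair_induced G S = \<lparr> pverts = S, parcs = parcs G \<inter> S \<times> S \<rparr>"

lemma with_proj_pair_induced: "with_proj (pair_induced G S) = with_proj G \<restriction> S"
  by (auto simp: pair_induced_def with_proj_def induce_subgraph_def)

lemma pair_induced_tensor_product:
  "pair_induced (tensor_product G1 G2) (S \<times> T) =
     tensor_product (pair_induced G1 S) (pair_induced G2 T)"
  by (auto simp: pair_induced_def tensor_product_def)

text \<open>An arc of a pair digraph is its pair of endpoints, so the vertex map determines the arc
  map, and an isomorphism record reduces to one injective function.\<close>

lemma digraph_iso_with_proj_iff:
  "digraph_iso (with_proj G) (with_proj H) \<longleftrightarrow> pair_wf_digraph G \<and>
     (\<exists>f. inj_on f (pverts G) \<and> pverts H = f ` pverts G \<and> parcs H = map_prod f f ` parcs G)"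
  (is "?iso \<longleftrightarrow> _ \<and> (\<exists>f. ?P f)")
proof
  assume ?iso
  then obtain h where h: "pre_digraph.digraph_isomorphism (with_proj G) h"
    and H: "with_proj H = app_iso h (with_proj G)"
    by (auto simp: digraph_iso_def)
  from H have "iso_tail h = fst" "iso_head h = snd"
    and V: "pverts H = iso_verts h ` pverts G" and A: "parcs H = iso_arcs h ` parcs G"
    by (auto simp: with_proj_def app_iso_def)
  \<comment> \<open>\<open>h\<close> respects tails and heads, which in \<open>H\<close> are the two
    components, so both components of the image arc are forced.\<close>
  with h have "iso_arcs h a = map_prod (iso_verts h) (iso_verts h) a" if "a \<in> parcs G" for a
    using that by (auto simp: pre_digraph.digraph_isomorphism_def prod_eq_iff)
  with A have "parcs H = map_prod (iso_verts h) (iso_verts h) ` parcs G"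
    by (simp cong: image_cong)
  with h V show "pair_wf_digraph G \<and> (\<exists>f. ?P f)"
    by (auto simp: pre_digraph.digraph_isomorphism_def wf_digraph_wp_iff)
next
  assume R: "pair_wf_digraph G \<and> (\<exists>f. ?P f)"
  then interpret pair_wf_digraph G by simp
  from R obtain f where f: "?P f" by blast
  let ?h = "\<lparr> iso_verts = f, iso_arcs = map_prod f f, iso_head = snd, iso_tail = fst \<rparr>"
  \<comment> \<open>Injectivity on arcs is inherited from vertices, since well-formedness places
    every arc in this square.\<close>
  have "inj_on (map_prod f f) (pverts G \<times> pverts G)"
    using f by (simp add: map_prod_inj_on)
  then have "inj_on (map_prod f f) (parcs G)"
    by (rule inj_on_subset) (auto dest: wellformed')
  with f have "pre_digraph.digraph_isomorphism (with_proj G) ?h"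
    by (simp add: pre_digraph.digraph_isomorphism_def wf_digraph_wp_iff pair_wf_digraph_axioms)
  moreover have "with_proj H = app_iso ?h (with_proj G)"
    using f by (simp add: with_proj_def app_iso_def)
  ultimately show ?iso by (auto simp: digraph_iso_def)
qed

text \<open>Vertex isomorphisms \<open>f\<close> and \<open>g\<close> of the factors combine to the
  isomorphism \<open>map_prod f g\<close>.\<close>

lemma digraph_iso_tensor_product:
  assumes "digraph_iso (with_proj G1) (with_proj H1)"
    and "digraph_iso (with_proj G2) (with_proj H2)"
  shows "digraph_iso (with_proj (tensor_product G1 G2)) (with_proj (tensor_product H1 H2))"
proof -
  from assms interpret G1: pair_wf_digraph G1 by (simp add: digraph_iso_with_proj_iff)
  from assms interpret G2: pair_wf_digraph G2 by (simp add: digraph_iso_with_proj_iff)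
  from assms obtain f g where
    f: "inj_on f (pverts G1)" "pverts H1 = f ` pverts G1" "parcs H1 = map_prod f f ` parcs G1" and
    g: "inj_on g (pverts G2)" "pverts H2 = g ` pverts G2" "parcs H2 = map_prod g g ` parcs G2"
    by (auto simp: digraph_iso_with_proj_iff)
  have "pair_wf_digraph (tensor_product G1 G2)"
    by unfold_locales (auto dest: G1.wellformed' G2.wellformed')
  moreover have "inj_on (map_prod f g) (pverts (tensor_product G1 G2))"
    using f g by (simp add: map_prod_inj_on)
  moreover have "pverts (tensor_product H1 H2) = map_prod f g ` pverts (tensor_product G1 G2)"
    using f g by (simp add: map_prod_surj_on)
  moreover have "parcs (tensor_product H1 H2) =
      map_prod (map_prod f g) (map_prod f g) ` parcs (tensor_product G1 G2)"
    (is "_ = ?F ` _")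
  proof (intro equalityI subsetI)
    \<comment> \<open>Lift the two factor arcs of \<open>e\<close> separately along \<open>f\<close>
      and \<open>g\<close>, then regroup their endpoints into an arc of the product.\<close>
    fix e assume "e \<in> parcs (tensor_product H1 H2)"
    then obtain x y x' y' where "(x, y) \<in> parcs G1" "(x', y') \<in> parcs G2"
      and e: "e = ((f x, g x'), (f y, g y'))"
      using f g by (cases e) auto
    then have "((x, x'), (y, y')) \<in> parcs (tensor_product G1 G2)" by simp
    then show "e \<in> ?F ` parcs (tensor_product G1 G2)"
      by (rule rev_image_eqI) (simp add: e)
  next
    fix e assume "e \<in> ?F ` parcs (tensor_product G1 G2)"
    then show "e \<in> parcs (tensor_product H1 H2)"
      using f g by auto
  qed
  ultimately show ?thesis by (auto simp: digraph_iso_with_proj_iff)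
qed

text \<open>The flipped rewrite turns \<open>\<restriction>\<close> into
  \<open>pair_induced\<close>, which splits over the product set; the factor isomorphisms then
  combine.\<close>

lemma uniform_shared_nbhd_tensor_product:
  assumes "uniform_shared_nbhd G1 H1" and "uniform_shared_nbhd G2 H2"
  shows "uniform_shared_nbhd (tensor_product G1 G2) (tensor_product H1 H2)"
  using assms
  by (auto simp: uniform_shared_nbhd_def pair_graph_tensor_product nbhd_tensor_product
      Times_Int_Times pair_induced_tensor_product simp flip: with_proj_pair_induced
      intro!: digraph_iso_tensor_product)

theorem theorem8:
  fixes G1 :: "'a pair_pre_digraph" and G2 :: "'b pair_pre_digraph"
    and H1 :: "'c pair_pre_digraph" and H2 :: "'d pair_pre_digraph"
    and n1 d1 l1 n2 d2 l2 :: nat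
  assumes "G1 \<in> ER n1 d1 l1" and "uniform_shared_nbhd G1 H1"
    and "G2 \<in> ER n2 d2 l2" and "uniform_shared_nbhd G2 H2"
  shows "tensor_product G1 G2 \<in> ER (n1 * n2) (d1 * d2) (l1 * l2)
    \<and> uniform_shared_nbhd (tensor_product G1 G2) (tensor_product H1 H2)"
  using assms by (simp add: ER_tensor_product uniform_shared_nbhd_tensor_product)

end
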